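(* Let $d\ge 1$ and let $f:[-\pi,\pi]\to\mathbb R^d$ be measurable with $$\int_{-\pi}^\pi\int_{-\pi}^\pi\frac{|f(u)-f(v)|^2}{|\sin\frac{u-v}2|}\,du\,dv<\infty .$$ Then $f\in L^2$, and the partial sum process $X$ of the Fourier series of $f$, enhanced by its area process, $\mathbf X=(X,A(X))$, is a geometric $2$-rough process. Moreover, $$\int_{-\pi}^{\pi}\|\mathbf X(\theta)\|_{G^{(2)}}^2\,d\theta\le(604+26C_0)\,k_{1/2}^{-1}\int_{-\pi}^\pi\int_{-\pi}^\pi\frac{|f(u)-f(v)|^2}{|\sin\frac{u-v}2|}\,du\,dv,$$ where $C_0$ is the Hardy constant for $L^2$ Fourier series and $k_{1/2}$ is the constant described in the context.
   Context: $\mathbb N=\{0,1,2,\dots\}$, $\bigtriangleup_{\mathbb N}=\{(i,j)\in\mathbb N^2: i\le j\}$; $|\cdot|$ is the Euclidean norm. Fourier series: for $f\in L^2([-\pi,\pi],\mathbb R^d)$ put $\hat f(k)=\frac1{2\pi}\int_{-\pi}^\pi f(\theta)e^{-ik\theta}d\theta$, $D_0f(\theta)=\hat f(0)$, $D_kf(\theta)=\hat f(k)e^{ik\theta}+\hat f(-k)e^{-ik\theta}$ for $k\ge1$. The partial sum process is $X_n(\theta)=\sum_{k=0}^nD_kf(\theta)\in\mathbb R^d$, $n\in\mathbb N$. Constants: $C_0$ is a finite constant such that $\int_{-\pi}^\pi\sup_{0\le i\le j<\infty}|\sum_{k=i}^jD_kg(\theta)|^2d\theta\le C_0\int_{-\pi}^\pi|g(\theta)|^2d\theta$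 for all real-valued $g\in L^2([-\pi,\pi])$ (it exists by the Carleson–Hunt theorem). $k_{1/2}>0$ is a constant, independent of $d$ and $f$, such that $k_{1/2}\sum_{n=0}^\infty\log_2(n+1)|c_n|^2\le\int_{-\pi}^\pi\int_{-\pi}^\pi\frac{|f(u)-f(v)|^2}{|\sin\frac{u-v}2|}du\,dv$ for all $f\in L^2([-\pi,\pi],\mathbb R^d)$, where $c_n=\int_{-\pi}^\pi f(\theta)e^{in\theta}d\theta\in\mathbb C^d$; such a constant exists. $\mathcal V=\mathbb R^d$; $\mathcal V\otimes\mathcal V$ carries a norm with $\|u\otimes v\|\le\|u\|\|v\|$; $[u,v]:=u\otimes v-v\otimes u$. $p$-variation: for $\alpha:\bigtriangleup_{\mathbb N}\to E$ ($E$ a Banach space) with $\alpha(k,k)=0$ and $p\in[1,\infty)$, $\|\alpha\|_{p\text{-}var}:=\sup_{N\ge1}\big(\sup_{0\le k_0<\cdots<k_n\le N}\sum_{j=0}^{n-1}\|\alpha(k_j,k_{j+1})\|^p\big)^{1/p}$. A function $\gamma:\mathbb N\to E$ is regarded as a function on $\bigtriangleup_{\mathbb N}$ via $(k_1,k_2)\mapsto\gamma(k_1)-\gamma(k_2)$. Area: for $\gamma:\mathbb N\to\mathcal V$, $A(\gamma)(k_1,k_2)=0$ if $k_2\in\{k_1,k_1+1\}$, and for $k_2\ge k_1+2$, $A(\gamma)(k_1,k_2)=\frac12\sum_{k_1\le j_1<j_2\le k_2-1}[\gamma(j_1+1)-\gamma(j_1),\gamma(j_2+1)-\gamma(j_2)]$.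 The area process is $(A(X))(\theta):=A(X(\theta))$. $2$-rough norm: $\|(\gamma,\alpha)\|_{G^{(2)}}:=(\|\gamma\|_{2\text{-}var}^2+\|\alpha\|_{1\text{-}var})^{1/2}$. $(X,A(X))$ is a geometric $2$-rough process if $\|(X(\theta),A(X(\theta)))\|_{G^{(2)}}<\infty$ for almost every $\theta$. *)

theory Defs
  imports "HOL-Analysis.Analysis"
begin

abbreviation circle_measure :: "real measure"
  where "circle_measure \<equiv> lebesgue_on {-pi..pi}"

definition L2_circle :: "(real \<Rightarrow> 'a::euclidean_space) \<Rightarrow> bool" where
  "L2_circle f \<longleftrightarrow> f \<in> borel_measurable circle_measure
     \<and> integrable circle_measure (\<lambda>\<theta>. (norm (f \<theta>))\<^sup>2)"

text \<open>The integrand is \<open>0\<close> by the convention \<open>x / 0 = 0\<close> where \<open>u - v\<close> is \<open>0\<close> or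
  \<open>\<plusminus>2\<pi>\<close>, a null set of pairs. The value may be infinite.\<close>

definition half_energy :: "(real \<Rightarrow> 'a::euclidean_space) \<Rightarrow> ennreal" where
  "half_energy f = (\<integral>\<^sup>+u. (\<integral>\<^sup>+v. ennreal ((norm (f u - f v))\<^sup>2 / \<bar>sin ((u - v) / 2)\<bar>)
     \<partial>circle_measure) \<partial>circle_measure)"

definition fourier_coeff :: "(real \<Rightarrow> real) \<Rightarrow> int \<Rightarrow> complex" where
  "fourier_coeff g k = 1 / (2 * of_real pi) *
     (LINT \<theta>|circle_measure. of_real (g \<theta>) * exp (- (\<i> * of_int k * of_real \<theta>)))"

definition fourier_term :: "(real \<Rightarrow> real) \<Rightarrow> nat \<Rightarrow> real \<Rightarrow> complex" where
  "fourier_term g k \<theta> =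
     (if k = 0 then fourier_coeff g 0
      else fourier_coeff g (int k) * exp (\<i> * of_nat k * of_real \<theta>)
         + fourier_coeff g (- int k) * exp (- (\<i> * of_nat k * of_real \<theta>)))"

lemma fourier_term_real: "Im (fourier_term g k \<theta>) = 0"
proof -
  have *: "fourier_coeff g (- j) = cnj (fourier_coeff g j)" for j
    unfolding fourier_coeff_def
    by (simp add: exp_cnj flip: Bochner_Integration.integral_cnj)
  have 0: "Im (fourier_coeff g 0) = 0"
    using *[of 0] by (simp add: complex_eq_iff)
  have "fourier_coeff g (- int k) * exp (- (\<i> * of_nat k * of_real \<theta>))
      = cnj (fourier_coeff g (int k) * exp (\<i> * of_nat k * of_real \<theta>))"
    by (simp add: * exp_cnj)
  then show ?thesis
    using 0 by (simp add: fourier_term_def)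
qed

text \<open>Taking the real part loses nothing, by \<open>fourier_term_real\<close>.\<close>

definition partial_sum_process :: "(real \<Rightarrow> real^'d) \<Rightarrow> real \<Rightarrow> nat \<Rightarrow> real^'d" where
  "partial_sum_process f \<theta> n = (\<chi> i. Re (\<Sum>k\<le>n. fourier_term (\<lambda>t. f t $ i) k \<theta>))"

definition raw_coeff :: "(real \<Rightarrow> real^'d) \<Rightarrow> nat \<Rightarrow> complex^'d" where
  "raw_coeff f n =
     (\<chi> i. LINT \<theta>|circle_measure. of_real (f \<theta> $ i) * exp (\<i> * of_nat n * of_real \<theta>))"

definition hardy_constant :: "real \<Rightarrow> bool" where
  "hardy_constant C \<longleftrightarrow> (\<forall>g :: real \<Rightarrow> real. L2_circle g \<longrightarrow>
     (\<integral>\<^sup>+\<theta>. (SUP (i, j)\<in>{(i, j). i \<le> j}. ennreal ((cmod (\<Sum>k=i..j. fourier_term g k \<theta>))\<^sup>2))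
        \<partial>circle_measure)
     \<le> ennreal C * (\<integral>\<^sup>+\<theta>. ennreal (\<bar>g \<theta>\<bar>\<^sup>2) \<partial>circle_measure))"

text \<open>The type argument selects the dimension \<open>d = CARD('d)\<close>.\<close>

definition half_energy_constant :: "'d::finite itself \<Rightarrow> real \<Rightarrow> bool" where
  "half_energy_constant _ c \<longleftrightarrow> 0 < c \<and> (\<forall>f :: real \<Rightarrow> real^'d. L2_circle f \<longrightarrow>
     ennreal c * (\<Sum>n. ennreal (log 2 (real n + 1) * (norm (raw_coeff f n))\<^sup>2)) \<le> half_energy f)"

definition variation_sums :: "('e \<Rightarrow> real) \<Rightarrow> real \<Rightarrow> (nat \<Rightarrow> nat \<Rightarrow> 'e) \<Rightarrow> nat \<Rightarrow> real set" where
  "variation_sums nrm p \<alpha> N =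
     {(\<Sum>j<n. nrm (\<alpha> (k j) (k (Suc j))) powr p) |n k. strict_mono_on {..n} k \<and> k n \<le> N}"

lemma bdd_above_variation_sums: "bdd_above (variation_sums nrm p \<alpha> N)"
proof (rule bdd_aboveI)
  fix x assume "x \<in> variation_sums nrm p \<alpha> N"
  then obtain n k where k: "strict_mono_on {..n} k" "k n \<le> N"
    and x: "x = (\<Sum>j<n. nrm (\<alpha> (k j) (k (Suc j))) powr p)"
    by (auto simp: variation_sums_def)
  have le: "k j \<le> N" if "j \<le> n" for j
    using k that by (metis atMost_iff le_refl le_trans strict_mono_on_leD)
  have inj: "inj_on (\<lambda>j. (k j, k (Suc j))) {..<n}"
    using strict_mono_on_imp_inj_on[OF k(1)] by (auto simp: inj_on_def)
  have "x = (\<Sum>(a, b)\<in>(\<lambda>j. (k j, k (Suc j))) ` {..<n}. nrm (\<alpha> a b) powr p)"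
    unfolding x by (subst sum.reindex[OF inj]) simp
  also have "\<dots> \<le> (\<Sum>(a, b)\<in>{..N} \<times> {..N}. nrm (\<alpha> a b) powr p)"
    by (rule sum_mono2) (auto simp: le)
  finally show "x \<le> (\<Sum>(a, b)\<in>{..N} \<times> {..N}. nrm (\<alpha> a b) powr p)" .
qed

text \<open>Only values \<open>\<alpha> k l\<close> with \<open>k < l\<close> enter, so \<open>\<alpha>\<close> is given as a total function.
  The inner supremum is finite by \<open>bdd_above_variation_sums\<close>; the outer one may be infinite.\<close>

definition p_variation :: "('e \<Rightarrow> real) \<Rightarrow> real \<Rightarrow> (nat \<Rightarrow> nat \<Rightarrow> 'e) \<Rightarrow> ennreal" where
  "p_variation nrm p \<alpha> = (SUP N\<in>{1..}. ennreal (Sup (variation_sums nrm p \<alpha> N) powr (1 / p)))"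

definition increments :: "(nat \<Rightarrow> 'e::real_normed_vector) \<Rightarrow> nat \<Rightarrow> nat \<Rightarrow> 'e" where
  "increments \<gamma> k l = \<gamma> k - \<gamma> l"

text \<open>\<open>\<real>\<^sup>d \<otimes> \<real>\<^sup>d\<close> is realised as the space of \<open>d \<times> d\<close> matrices.\<close>

definition tensor :: "real^'d \<Rightarrow> real^'d \<Rightarrow> real^'d^'d" where
  "tensor u v = (\<chi> i j. u $ i * v $ j)"

definition bracket :: "real^'d \<Rightarrow> real^'d \<Rightarrow> real^'d^'d" where
  "bracket u v = tensor u v - tensor v u"

definition is_norm :: "('a::real_vector \<Rightarrow> real) \<Rightarrow> bool" where
  "is_norm nrm \<longleftrightarrow> (\<forall>x. nrm x \<ge> 0) \<and> (\<forall>x. nrm x = 0 \<longleftrightarrow> x = 0)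
     \<and> (\<forall>a x. nrm (a *\<^sub>R x) = \<bar>a\<bar> * nrm x) \<and> (\<forall>x y. nrm (x + y) \<le> nrm x + nrm y)"

definition tensor_norm :: "(real^'d^'d \<Rightarrow> real) \<Rightarrow> bool" where
  "tensor_norm nrm \<longleftrightarrow> is_norm nrm \<and> (\<forall>u v. nrm (tensor u v) \<le> norm u * norm v)"

definition area :: "(nat \<Rightarrow> real^'d) \<Rightarrow> nat \<Rightarrow> nat \<Rightarrow> real^'d^'d" where
  "area \<gamma> k l =
     (if l \<le> k + 1 then 0
      else (1 / 2) *\<^sub>R (\<Sum>(i, j)\<in>{(i, j). k \<le> i \<and> i < j \<and> j \<le> l - 1}.
             bracket (\<gamma> (i + 1) - \<gamma> i) (\<gamma> (j + 1) - \<gamma> j)))"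

definition ennreal_sqrt :: "ennreal \<Rightarrow> ennreal" where
  "ennreal_sqrt x = (if x = \<infinity> then \<infinity> else ennreal (sqrt (enn2real x)))"

lemma ennreal_sqrt_square: "(ennreal_sqrt x)\<^sup>2 = x"
  by (cases x) (auto simp: ennreal_sqrt_def ennreal_power)

definition rough_norm ::
  "(real^'d^'d \<Rightarrow> real) \<Rightarrow> (nat \<Rightarrow> real^'d) \<times> (nat \<Rightarrow> nat \<Rightarrow> real^'d^'d) \<Rightarrow> ennreal" where
  "rough_norm nrm = (\<lambda>(\<gamma>, \<alpha>).
     ennreal_sqrt ((p_variation norm 2 (increments \<gamma>))\<^sup>2 + p_variation nrm 1 \<alpha>))"

definition area_process :: "(real \<Rightarrow> nat \<Rightarrow> real^'d) \<Rightarrow> real \<Rightarrow> nat \<Rightarrow> nat \<Rightarrow> real^'d^'d" where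
  "area_process X \<theta> = area (X \<theta>)"

definition enhanced ::
  "(real \<Rightarrow> nat \<Rightarrow> real^'d) \<Rightarrow> real \<Rightarrow> (nat \<Rightarrow> real^'d) \<times> (nat \<Rightarrow> nat \<Rightarrow> real^'d^'d)" where
  "enhanced X \<theta> = (X \<theta>, area_process X \<theta>)"

definition geometric_2_rough_process :: "(real^'d^'d \<Rightarrow> real) \<Rightarrow>
    (real \<Rightarrow> (nat \<Rightarrow> real^'d) \<times> (nat \<Rightarrow> nat \<Rightarrow> real^'d^'d)) \<Rightarrow> bool" where
  "geometric_2_rough_process nrm XX \<longleftrightarrow> (AE \<theta> in circle_measure. rough_norm nrm (XX \<theta>) < \<infinity>)"

end

theory Submission
  imports Defs
begin

text \<open>
  Let \<open>D n\<close> be the \<open>n\<close>-th Fourier term of \<open>f\<close>, so that the increment of the partial sum process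
  \<open>X\<close> over \<open>{k<..l}\<close> is the sum of the \<open>D n\<close> with \<open>n \<in> {k<..l}\<close>. The proof is a Rademacher--Menshov
  argument in which the maximal inequality saves one logarithm.

  Every \<open>m \<ge> 1\<close> is the split point of one set \<open>node m\<close> in a binary tree of intervals: the dyadic
  intervals inside the blocks \<open>{2 ^ t<..2 ^ (t + 1)}\<close>, together with the half-lines that cut off
  first \<open>{1}\<close> and then one such block after the other. Every interval \<open>{k<..l}\<close> with at least two elements lies in the node
  of some \<open>m\<close> strictly between \<open>k\<close> and \<open>l\<close> (\<open>node_contains_interval\<close>), and yet \<open>n\<close> lies in only
  \<open>O(log (n + 1))\<close> nodes (\<open>node_overlap\<close>).

  Let \<open>c m\<close> be the maximal square of a sum of consecutive terms \<open>D n\<close> with all indices in \<open>node m\<close>,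
  the maximum being taken in each coordinate.
  Two quantities \<open>\<omega> k l\<close> satisfy \<open>\<omega> k l \<le> \<omega> k m + \<omega> m l + c m\<close> whenever \<open>k < m < l\<close> and
  \<open>{k<..l} \<subseteq> node m\<close>: the squared increment of \<open>X\<close>, which is itself at most \<open>c m\<close>, and the norm of
  the area, because Chen's relation (\<open>area_chen\<close>) writes the defect of additivity of the area as
  half a bracket of two increments inside the node. Repeated splitting bounds \<open>\<omega> k l\<close> by the sum of
  \<open>c m\<close> over \<open>k < m < l\<close> and of the contributions of the single indices. That bound is superadditive
  in the interval, so it controls the sum of \<open>\<omega>\<close> over any partition (\<open>partition_control\<close>), hence
  both variations, pointwise in \<open>\<theta>\<close>.

  It remains to integrate. The Hardy inequality, applied to the trigonometric polynomials with
  frequencies in finite pieces of \<open>node m\<close>, bounds the integral of \<open>c m\<close> by \<open>C\<^sub>0\<close> times the energy of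
  the terms with index in the node (\<open>hardy_block_max\<close>). By the overlap bound the sum over all \<open>m\<close> is
  at most a constant times the sum of \<open>log 2 (n + 1)\<close> times the squared norm of \<open>raw_coeff f n\<close>, which the hypothesis on \<open>k_half\<close>
  compares with the half energy.
\<close>

section \<open>A binary tree of intervals and superadditive controls\<close>

text \<open>Powers of two carry the half-lines; an \<open>m\<close> that is not a power of two, with exact power \<open>2 ^ v\<close>
  dividing it, carries \<open>{m - 2 ^ v<..m + 2 ^ v}\<close>. The condition \<open>1 \<le> q\<close> excludes the powers of two. Since
  \<open>2 ^ 0 div 2 = 0\<close>, the root \<open>node 1\<close> consists of all positive numbers.\<close>

definition node :: "nat \<Rightarrow> nat set" where
  "node m = {n. \<exists>t. m = 2 ^ t \<and> 2 ^ t div 2 < n}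
     \<union> {n. \<exists>v q. 1 \<le> q \<and> m = 2 ^ v * (2 * q + 1) \<and> 2 ^ (v + 1) * q < n \<and> n \<le> 2 ^ (v + 1) * (q + 1)}"

lemma zero_notin_node: "0 \<notin> node m"
  by (simp add: node_def)

text \<open>If a power of two lies strictly between \<open>k\<close> and \<open>l\<close>, the least one serves as \<open>m\<close>: half of it is at
  most \<open>k\<close>. Otherwise \<open>m\<close> is a number between them that is divisible by the largest possible power of two; the
  neighbouring multiples of the next power lie outside and so enclose the interval.\<close>

lemma node_contains_interval:
  assumes "k + 2 \<le> l"
  shows "\<exists>m. k < m \<and> m < l \<and> {k<..l} \<subseteq> node m"
proof (cases "\<exists>t. k < 2 ^ t \<and> 2 ^ t < l")
  case True
  then obtain t0 where t0: "k < 2 ^ t0" "(2::nat) ^ t0 < l" by blast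
  define t where "t = (LEAST t. k < 2 ^ t)"
  have t: "k < 2 ^ t" "t \<le> t0"
    unfolding t_def using t0 by (auto intro: LeastI Least_le)
  have "(2::nat) ^ t \<le> 2 ^ t0"
    using t(2) by (intro power_increasing) auto
  then have "(2::nat) ^ t < l" using t0(2) by (rule le_less_trans)
  moreover have "2 ^ t div 2 \<le> k"
  proof (cases t)
    case (Suc s)
    then have "\<not> k < 2 ^ s"
      using not_less_Least[of s "\<lambda>t. k < 2 ^ t"] by (simp add: t_def)
    with Suc show ?thesis by simp
  qed simp
  ultimately show ?thesis
    using t(1) by (intro exI[of _ "2 ^ t"]) (auto simp: node_def)
next
  case False
  define P where "P = (\<lambda>v. \<exists>r. k < 2 ^ v * r \<and> 2 ^ v * r < l)"
  have "P 0" using assms by (auto simp: P_def intro!: exI[of _ "k + 1"])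
  moreover have bound: "v \<le> l" if "P v" for v
  proof -
    from that obtain r where r: "k < 2 ^ v * r" "2 ^ v * r < l" by (auto simp: P_def)
    then have "r \<ge> 1" by (cases r) auto
    then have "(2::nat) ^ v \<le> 2 ^ v * r" by simp
    moreover have "v < 2 ^ v" by (rule less_exp)
    ultimately show ?thesis using r by linarith
  qed
  ultimately obtain v where v: "P v" and vmax: "\<And>w. P w \<Longrightarrow> w \<le> v"
    using Nat.ex_has_greatest_nat[of P 0 l] by auto
  obtain r where r: "k < 2 ^ v * r" "2 ^ v * r < l" using v by (auto simp: P_def)
  \<comment> \<open>\<open>v\<close> is maximal, so no multiple of \<open>2 ^ (v + 1)\<close> lies strictly between \<open>k\<close> and \<open>l\<close>.\<close>
  have next_level: "\<not> (k < 2 ^ (v + 1) * s \<and> 2 ^ (v + 1) * s < l)" for s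
    using vmax[of "v + 1"] by (auto simp: P_def)
  have "odd r"
  proof
    assume "even r"
    then obtain s where "r = 2 * s" by (elim evenE)
    then show False using next_level[of s] r by (simp add: mult_ac)
  qed
  then obtain q where q: "r = 2 * q + 1" by (elim oddE)
  have "q \<ge> 1"
    \<comment> \<open>\<open>q = 0\<close> would make the chosen point the power of two \<open>2 ^ v\<close>.\<close>
    using False r q by (cases q) auto
  moreover have "2 ^ (v + 1) * q \<le> k" "l \<le> 2 ^ (v + 1) * (q + 1)"
  proof -
    have "2 ^ (v + 1) * q < 2 ^ v * r" "2 ^ v * r < 2 ^ (v + 1) * (q + 1)"
      by (simp_all add: q algebra_simps)
    then show "2 ^ (v + 1) * q \<le> k" "l \<le> 2 ^ (v + 1) * (q + 1)"
      using next_level[of q] next_level[of "q + 1"] r by linarith+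
  qed
  ultimately have "{k<..l} \<subseteq> node (2 ^ v * r)"
    unfolding node_def q by fastforce
  with r show ?thesis by blast
qed

text \<open>At each scale \<open>v\<close> only one node that is not a half-line contains \<open>n\<close>, and all
  scales that occur satisfy \<open>2 ^ v \<le> 2 * n\<close>. The bound is a multiple of \<open>log 2 (n + 1)\<close>, without an
  additive constant, because \<open>log 2 (n + 1) \<ge> 1\<close> for \<open>n \<ge> 1\<close>.\<close>

lemma node_overlap:
  assumes "1 \<le> n"
  shows "finite {m. n \<in> node m}" "real (card {m. n \<in> node m}) \<le> 6 * log 2 (real n + 1)"
proof -
  define T where "T = {t. (2::nat) ^ t \<le> 2 * n}"
  have T: "t \<le> floor (log 2 (2 * real n))" if "t \<in> T" for t
  proof -
    have "(2::real) ^ t \<le> 2 * real n"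
    proof -
      have "real (2 ^ t) \<le> real (2 * n)"
        using that unfolding T_def of_nat_le_iff by blast
      then show ?thesis by simp
    qed
    then have "real t \<le> log 2 (2 * real n)"
      using assms by (simp add: le_log_iff powr_realpow)
    then show ?thesis by linarith
  qed
  then have T_sub: "T \<subseteq> {..nat (floor (log 2 (2 * real n)))}" by force
  then have finT: "finite T" by (rule finite_subset) simp
  have "card T \<le> nat (floor (log 2 (2 * real n))) + 1"
    using card_mono[OF _ T_sub] by simp
  moreover have "0 \<le> log 2 (2 * real n)" using assms by simp
  ultimately have "real (card T) \<le> log 2 (2 * real n) + 1" by linarith
  also have "\<dots> = log 2 (real n) + 2"
    using assms by (simp add: log_mult)
  also have "\<dots> \<le> 3 * log 2 (real n + 1)"
  proof -
    have "log 2 (real n) \<le> log 2 (real n + 1)" "1 \<le> log 2 (real n + 1)"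
      using assms by simp_all
    then show ?thesis by linarith
  qed
  finally have cardT: "real (card T) \<le> 3 * log 2 (real n + 1)" .
  have sub: "{m. n \<in> node m} \<subseteq> (\<lambda>t. 2 ^ t) ` T \<union> (\<lambda>v. 2 ^ v * (2 * ((n - 1) div 2 ^ (v + 1)) + 1)) ` T"
  proof
    fix m assume "m \<in> {m. n \<in> node m}"
    then consider (power) t where "m = 2 ^ t" "2 ^ t div 2 < n"
      | (dyadic) v q where "1 \<le> q" "m = 2 ^ v * (2 * q + 1)" "2 ^ (v + 1) * q < n" "n \<le> 2 ^ (v + 1) * (q + 1)"
      by (auto simp: node_def)
    then show "m \<in> (\<lambda>t. 2 ^ t) ` T \<union> (\<lambda>v. 2 ^ v * (2 * ((n - 1) div 2 ^ (v + 1)) + 1)) ` T"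
    proof cases
      case power
      then have "(2::nat) ^ t \<le> 2 * n" by linarith
      then have "t \<in> T" unfolding T_def by blast
      with power show ?thesis by blast
    next
      case dyadic
      have "(n - 1) div 2 ^ (v + 1) = q"
        using dyadic by (intro div_nat_eqI) (auto simp: algebra_simps)
      moreover have "(2::nat) ^ v \<le> 2 ^ (v + 1) * q" using dyadic by simp
      then have "(2::nat) ^ v \<le> 2 * n" using dyadic(3) by linarith
      then have "v \<in> T" unfolding T_def by blast
      ultimately show ?thesis using dyadic(2) by blast
    qed
  qed
  then show "finite {m. n \<in> node m}" by (rule finite_subset) (simp add: finT)
  have "card {m. n \<in> node m} \<le> card T + card T"
    using card_mono[OF _ sub] finT
    by (meson card_Un_le card_image_le add_mono finite_UnI finite_imageI order_trans)
  with cardT show "real (card {m. n \<in> node m}) \<le> 6 * log 2 (real n + 1)" by linarith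
qed

text \<open>Splitting at the point \<open>m\<close> that \<open>node_contains_interval\<close> provides uses up the
  cost \<open>c m\<close>, and \<open>m\<close> is strictly inside neither half, so no cost is paid twice.\<close>

lemma interval_control:
  fixes \<omega> :: "nat \<Rightarrow> nat \<Rightarrow> ennreal"
  assumes single: "\<And>k. \<omega> k (k + 1) \<le> b (k + 1)"
    and split: "\<And>k m l. k < m \<Longrightarrow> m < l \<Longrightarrow> {k<..l} \<subseteq> node m \<Longrightarrow> \<omega> k l \<le> \<omega> k m + \<omega> m l + c m"
    and "k < l"
  shows "\<omega> k l \<le> sum c {k<..<l} + sum b {k<..l}"
  using \<open>k < l\<close>
proof (induction "l - k" arbitrary: k l rule: less_induct)
  case less
  show ?case
  proof (cases "l = k + 1")
    case True
    then have "{k<..<l} = {}" "{k<..l} = {l}" by auto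
    then show ?thesis using single[of k] True by simp
  next
    case False
    with less.prems have "k + 2 \<le> l" by simp
    from node_contains_interval[OF this] obtain m
      where m: "k < m" "m < l" "{k<..l} \<subseteq> node m" by blast
    have "\<omega> k l \<le> \<omega> k m + \<omega> m l + c m" by (rule split) fact+
    also have "\<dots> \<le> (sum c {k<..<m} + sum b {k<..m}) + (sum c {m<..<l} + sum b {m<..l}) + c m"
      using m by (intro add_mono less.hyps) auto
    also have "\<dots> = sum c ({k<..<m} \<union> insert m {m<..<l}) + sum b ({k<..m} \<union> {m<..l})"
      by (subst sum.union_disjoint, simp, simp, force)+ (simp add: ac_simps)
    also have "{k<..<m} \<union> insert m {m<..<l} = {k<..<l}" using m by auto
    also have "{k<..m} \<union> {m<..l} = {k<..l}" using m by auto
    finally show ?thesis .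
  qed
qed

text \<open>The bound of \<open>interval_control\<close> is superadditive in the interval, so summing it over a
  partition does not exceed its value on the whole range.\<close>

lemma partition_control:
  fixes \<omega> :: "nat \<Rightarrow> nat \<Rightarrow> ennreal"
  assumes "\<And>k. \<omega> k (k + 1) \<le> b (k + 1)"
    and "\<And>k m l. k < m \<Longrightarrow> m < l \<Longrightarrow> {k<..l} \<subseteq> node m \<Longrightarrow> \<omega> k l \<le> \<omega> k m + \<omega> m l + c m"
    and "strict_mono_on {..n} k"
  shows "(\<Sum>j<n. \<omega> (k j) (k (Suc j))) \<le> suminf c + suminf b"
proof -
  have control: "\<omega> k l \<le> sum c {k<..<l} + sum b {k<..l}" if "k < l" for k l
    by (rule interval_control[where b = b and c = c and \<omega> = \<omega>]) (fact assms(1) assms(2) that)+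
  have "(\<Sum>j<n. \<omega> (k j) (k (Suc j))) \<le> sum c {k 0<..<k n} + sum b {k 0<..k n}"
    using assms(3)
  proof (induction n)
    case (Suc n)
    have sm: "strict_mono_on {..n} k"
      using Suc.prems by (auto simp: strict_mono_on_def)
    have lt: "k n < k (Suc n)"
      by (rule strict_mono_onD[OF Suc.prems]) auto
    have le: "k 0 \<le> k n"
      by (rule strict_mono_on_leD[OF sm]) auto
    have "(\<Sum>j<Suc n. \<omega> (k j) (k (Suc j)))
        \<le> (sum c {k 0<..<k n} + sum b {k 0<..k n}) + (sum c {k n<..<k (Suc n)} + sum b {k n<..k (Suc n)})"
      unfolding sum.lessThan_Suc
      by (intro add_mono Suc.IH sm control lt)
    also have "\<dots> = sum c ({k 0<..<k n} \<union> {k n<..<k (Suc n)}) + sum b ({k 0<..k n} \<union> {k n<..k (Suc n)})"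
      by (subst sum.union_disjoint, simp, simp, force)+ (simp add: ac_simps)
    also have "\<dots> \<le> sum c {k 0<..<k (Suc n)} + sum b {k 0<..k (Suc n)}"
      using lt le by (intro add_mono sum_mono2) auto
    finally show ?case .
  qed simp
  also have "\<dots> \<le> suminf c + suminf b"
    by (intro add_mono sum_le_suminf) auto
  finally show ?thesis .
qed

lemma p_variation_le:
  assumes p: "0 < p" and le: "\<And>n k. strict_mono_on {..n} k \<Longrightarrow> (\<Sum>j<n. ennreal (nrm (\<alpha> (k j) (k (Suc j))) powr p)) \<le> ennreal \<psi>"
    and "0 \<le> \<psi>"
  shows "p_variation nrm p \<alpha> \<le> ennreal (\<psi> powr (1 / p))"
  unfolding p_variation_def
proof (rule SUP_least)
  fix N :: nat
  have mem: "0 \<in> variation_sums nrm p \<alpha> N"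
    unfolding variation_sums_def by (auto intro!: exI[of _ 0] exI[of _ "\<lambda>_. 0"] simp: strict_mono_on_def)
  have ub: "x \<le> \<psi>" if x: "x \<in> variation_sums nrm p \<alpha> N" for x
  proof -
    obtain n k where k: "strict_mono_on {..n} k" "x = (\<Sum>j<n. nrm (\<alpha> (k j) (k (Suc j))) powr p)"
      using x unfolding variation_sums_def by blast
    with le[OF k(1)] show ?thesis
      using \<open>0 \<le> \<psi>\<close> by (simp add: sum_ennreal)
  qed
  have "Sup (variation_sums nrm p \<alpha> N) \<le> \<psi>"
    using mem ub by (intro cSup_least) auto
  moreover have "0 \<le> Sup (variation_sums nrm p \<alpha> N)"
    using mem bdd_above_variation_sums by (rule cSup_upper)
  ultimately show "ennreal (Sup (variation_sums nrm p \<alpha> N) powr (1 / p)) \<le> ennreal (\<psi> powr (1 / p))"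
    using p by (intro ennreal_leI powr_mono2) auto
qed

section \<open>Trigonometric polynomials\<close>

lemma continuous_integrable_circle:
  fixes h :: "real \<Rightarrow> 'a::euclidean_space"
  assumes "continuous_on UNIV h"
  shows "integrable circle_measure h"
proof -
  have "set_integrable lborel {-pi..pi} h"
    using assms by (intro borel_integrable_atLeastAtMost') (rule continuous_on_subset, auto)
  then have 1: "integrable lborel (\<lambda>x. indicator {-pi..pi} x *\<^sub>R h x)"
    by (simp only: set_integrable_def)
  have "set_integrable lebesgue {-pi..pi} h"
    unfolding set_integrable_def
    using integrable_completion[OF borel_measurable_integrable[OF 1]] 1 by blast
  then show ?thesis
    by (simp add: set_integrable_def integrable_restrict_space)
qed

lemma circle_integral_exp:
  "(LINT \<theta>|circle_measure. exp (\<i> * of_int k * of_real \<theta>)) = (if k = 0 then 2 * of_real pi else 0)"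
proof -
  have "(LINT \<theta>|circle_measure. exp (\<i> * of_int k * of_real \<theta>)) = integral {-pi..pi} (\<lambda>\<theta>. exp (\<i> * of_int k * of_real \<theta>))"
    by (intro lebesgue_integral_eq_integral continuous_integrable_circle continuous_intros) auto
  also have "\<dots> = (if k = 0 then 2 * of_real pi else 0)"
  proof (cases "k = 0")
    case False
    define F where "F = (\<lambda>z. exp (\<i> * of_int k * z) / (\<i> * of_int k))"
    have "(F has_field_derivative exp (\<i> * of_int k * z)) (at z)" for z
      unfolding F_def using False by (auto intro!: derivative_eq_intros)
    then have "((\<lambda>\<theta>. exp (\<i> * of_int k * of_real \<theta>)) has_integral (F (of_real pi) - F (of_real (- pi)))) {-pi..pi}"
      by (intro fundamental_theorem_of_calculus has_vector_derivative_real_field) auto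
    moreover have "F (of_real pi) = F (of_real (- pi))"
    proof -
      have "\<i> * of_int k * of_real pi = \<i> * of_int k * of_real (- pi) + 2 * of_int k * pi * \<i>"
        by (simp add: algebra_simps)
      then have "exp (\<i> * of_int k * of_real pi) = exp (\<i> * of_int k * of_real (- pi)) * exp (2 * of_int k * pi * \<i>)"
        by (simp only: exp_add)
      also have "exp (2 * of_int k * pi * \<i>) = 1"
        by (rule exp_integer_2pi) simp
      finally show ?thesis by (simp only: F_def mult_1_right)
    qed
    ultimately show ?thesis using False by (simp add: integral_unique)
  qed (simp add: scaleR_conv_of_real)
  finally show ?thesis .
qed

lemma fourier_term_eq:
  "0 < n \<Longrightarrow> fourier_term g n \<theta>
     = fourier_coeff g (int n) * exp (\<i> * of_int (int n) * of_real \<theta>)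
       + fourier_coeff g (- int n) * exp (\<i> * of_int (- int n) * of_real \<theta>)"
  by (simp add: fourier_term_def)

lemma fourier_coeff_uminus: "fourier_coeff g (- k) = cnj (fourier_coeff g k)"
  unfolding fourier_coeff_def by (simp add: exp_cnj flip: Bochner_Integration.integral_cnj)

definition fourier_block :: "(real \<Rightarrow> real) \<Rightarrow> nat set \<Rightarrow> real \<Rightarrow> real" where
  "fourier_block g K \<theta> = Re (\<Sum>n\<in>K. fourier_term g n \<theta>)"

lemma of_real_fourier_block: "complex_of_real (fourier_block g K \<theta>) = (\<Sum>n\<in>K. fourier_term g n \<theta>)"
  by (simp add: fourier_block_def complex_eq_iff fourier_term_real Im_sum)

lemma continuous_on_fourier_term [continuous_intros]: "continuous_on A (fourier_term g n)"
proof (cases "n = 0")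
  case True
  then show ?thesis by (simp add: fourier_term_def[abs_def])
next
  case False
  then show ?thesis by (simp add: fourier_term_def[abs_def]) (intro continuous_intros)
qed

lemma continuous_on_fourier_block [continuous_intros]: "continuous_on A (fourier_block g K)"
  unfolding fourier_block_def[abs_def] by (intro continuous_intros)

lemma L2_circle_fourier_block: "L2_circle (fourier_block g K)"
  unfolding L2_circle_def
  by (intro conjI borel_measurable_integrable[OF continuous_integrable_circle] continuous_integrable_circle continuous_intros)

text \<open>Orthogonality of the exponentials. The frequency \<open>0\<close> is excluded because \<open>fourier_term\<close> treats
  it separately from the pairs of frequencies \<open>n\<close> and \<open>- n\<close>.\<close>

lemma fourier_coeff_block:
  assumes "finite K" "0 \<notin> K"
  shows "fourier_coeff (fourier_block g K) j = (if nat \<bar>j\<bar> \<in> K then fourier_coeff g j else 0)"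
proof -
  let ?E = "\<lambda>k \<theta>. exp (\<i> * of_int k * of_real \<theta>) :: complex"
  let ?c = "fourier_coeff g"
  have int: "integrable circle_measure (\<lambda>\<theta>. a * ?E k \<theta>)" for a k
    by (intro continuous_integrable_circle continuous_intros)
  have "(LINT \<theta>|circle_measure. of_real (fourier_block g K \<theta>) * exp (- (\<i> * of_int j * of_real \<theta>)))
      = (LINT \<theta>|circle_measure. (\<Sum>n\<in>K. ?c (int n) * ?E (int n - j) \<theta> + ?c (- int n) * ?E (- int n - j) \<theta>))"
    unfolding of_real_fourier_block sum_distrib_right
  proof (intro Bochner_Integration.integral_cong refl sum.cong)
    fix \<theta> n assume "n \<in> K"
    then have "0 < n" using assms(2) by (cases n) auto
    then show "fourier_term g n \<theta> * exp (- (\<i> * of_int j * of_real \<theta>))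
        = ?c (int n) * ?E (int n - j) \<theta> + ?c (- int n) * ?E (- int n - j) \<theta>"
      by (simp add: fourier_term_eq distrib_right mult.assoc flip: exp_add) (simp add: algebra_simps)
  qed
  also have "\<dots> = (\<Sum>n\<in>K. ?c (int n) * (if int n = j then 2 * of_real pi else 0)
      + ?c (- int n) * (if - int n = j then 2 * of_real pi else 0))"
    by (subst Bochner_Integration.integral_sum, intro Bochner_Integration.integrable_add int)
      (simp add: int circle_integral_exp del: of_int_diff of_int_minus cong: if_cong)
  also have "\<dots> = (\<Sum>n\<in>K. if n = nat \<bar>j\<bar> then 2 * of_real pi * ?c j else 0)"
  proof (intro sum.cong refl)
    fix n assume "n \<in> K"
    then have "0 < n" using assms(2) by (cases n) auto
    then show "?c (int n) * (if int n = j then 2 * of_real pi else 0)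
      + ?c (- int n) * (if - int n = j then 2 * of_real pi else 0) = (if n = nat \<bar>j\<bar> then 2 * of_real pi * ?c j else 0)"
      by auto
  qed
  also have "\<dots> = (if nat \<bar>j\<bar> \<in> K then 2 * of_real pi * ?c j else 0)"
    using assms(1) by (rule sum.delta)
  finally show ?thesis
    unfolding fourier_coeff_def[of "fourier_block g K"] by simp
qed

lemma fourier_term_block:
  assumes "finite K" "0 \<notin> K"
  shows "fourier_term (fourier_block g K) n \<theta> = (if n \<in> K then fourier_term g n \<theta> else 0)"
  using assms by (auto simp: fourier_term_def fourier_coeff_block)

text \<open>Expanding only one of the two factors turns the integral into a combination of
  Fourier coefficients of the block itself, which \<open>fourier_coeff_block\<close> evaluates.\<close>

lemma integral_fourier_block_square:
  assumes "finite K" "0 \<notin> K"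
  shows "(LINT \<theta>|circle_measure. (fourier_block g K \<theta>)\<^sup>2) = (\<Sum>n\<in>K. 4 * pi * (cmod (fourier_coeff g (int n)))\<^sup>2)"
proof -
  let ?b = "fourier_block g K" and ?c = "fourier_coeff g"
  let ?E = "\<lambda>k \<theta>. exp (- (\<i> * of_int k * of_real \<theta>)) :: complex"
  have int: "integrable circle_measure (\<lambda>\<theta>. a * (of_real (?b \<theta>) * ?E k \<theta>))" for a k
    by (intro continuous_integrable_circle continuous_intros)
  have coeff: "(LINT \<theta>|circle_measure. of_real (?b \<theta>) * ?E k \<theta>) = 2 * of_real pi * fourier_coeff ?b k" for k
    by (simp add: fourier_coeff_def)
  have "complex_of_real (LINT \<theta>|circle_measure. (?b \<theta>)\<^sup>2) = (LINT \<theta>|circle_measure. of_real ((?b \<theta>)\<^sup>2))"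
    by (rule integral_complex_of_real[symmetric])
  also have "\<dots> = (LINT \<theta>|circle_measure.
      (\<Sum>n\<in>K. ?c (int n) * (of_real (?b \<theta>) * ?E (- int n) \<theta>) + ?c (- int n) * (of_real (?b \<theta>) * ?E (int n) \<theta>)))"
  proof (intro Bochner_Integration.integral_cong refl)
    fix \<theta>
    have "complex_of_real ((?b \<theta>)\<^sup>2) = (\<Sum>n\<in>K. of_real (?b \<theta>) * fourier_term g n \<theta>)"
      by (simp add: power2_eq_square of_real_fourier_block[symmetric] flip: sum_distrib_left)
    also have "\<dots> = (\<Sum>n\<in>K. ?c (int n) * (of_real (?b \<theta>) * ?E (- int n) \<theta>) + ?c (- int n) * (of_real (?b \<theta>) * ?E (int n) \<theta>))"
    proof (intro sum.cong refl)
      fix n assume "n \<in> K"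
      then have "0 < n" using assms(2) by (cases n) auto
      then show "of_real (?b \<theta>) * fourier_term g n \<theta>
        = ?c (int n) * (of_real (?b \<theta>) * ?E (- int n) \<theta>) + ?c (- int n) * (of_real (?b \<theta>) * ?E (int n) \<theta>)"
        by (simp add: fourier_term_eq algebra_simps)
    qed
    finally show "complex_of_real ((?b \<theta>)\<^sup>2) = (\<Sum>n\<in>K. ?c (int n) * (of_real (?b \<theta>) * ?E (- int n) \<theta>) + ?c (- int n) * (of_real (?b \<theta>) * ?E (int n) \<theta>))" .
  qed
  also have "\<dots> = (\<Sum>n\<in>K. ?c (int n) * (2 * of_real pi * fourier_coeff ?b (- int n))
      + ?c (- int n) * (2 * of_real pi * fourier_coeff ?b (int n)))"
    unfolding coeff[symmetric]
    by (subst Bochner_Integration.integral_sum, intro Bochner_Integration.integrable_add int)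
      (subst Bochner_Integration.integral_add, (rule int)+, simp)
  also have "\<dots> = (\<Sum>n\<in>K. of_real (4 * pi * (cmod (?c (int n)))\<^sup>2))"
  proof (intro sum.cong refl)
    fix n assume "n \<in> K"
    have "?c (int n) * ?c (- int n) = of_real ((cmod (?c (int n)))\<^sup>2)"
      unfolding fourier_coeff_uminus by (rule complex_norm_square[symmetric])
    with \<open>n \<in> K\<close> show "?c (int n) * (2 * of_real pi * fourier_coeff ?b (- int n))
      + ?c (- int n) * (2 * of_real pi * fourier_coeff ?b (int n)) = of_real (4 * pi * (cmod (?c (int n)))\<^sup>2)"
      by (simp add: fourier_coeff_block[OF assms] algebra_simps)
  qed
  finally have "complex_of_real (LINT \<theta>|circle_measure. (?b \<theta>)\<^sup>2) = of_real (\<Sum>n\<in>K. 4 * pi * (cmod (?c (int n)))\<^sup>2)"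
    by simp
  then show ?thesis by (simp only: of_real_eq_iff)
qed

lemma nn_integral_fourier_block_square:
  assumes "finite K" "0 \<notin> K"
  shows "(\<integral>\<^sup>+\<theta>. ennreal ((fourier_block g K \<theta>)\<^sup>2) \<partial>circle_measure) = (\<Sum>n\<in>K. ennreal (4 * pi * (cmod (fourier_coeff g (int n)))\<^sup>2))"
  by (subst nn_integral_eq_integral)
    (auto intro!: continuous_integrable_circle continuous_intros simp: integral_fourier_block_square[OF assms] sum_ennreal)

section \<open>The maximal inequality on a set of frequencies\<close>

definition max_sum :: "(real \<Rightarrow> real) \<Rightarrow> nat set \<Rightarrow> real \<Rightarrow> ennreal" where
  "max_sum g J \<theta> = (SUP (p, q)\<in>{(p, q). p \<le> q \<and> {p..q} \<subseteq> J}. ennreal ((cmod (\<Sum>k=p..q. fourier_term g k \<theta>))\<^sup>2))"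

lemma max_sum_upper:
  "p \<le> q \<Longrightarrow> {p..q} \<subseteq> J \<Longrightarrow> ennreal ((cmod (\<Sum>k=p..q. fourier_term g k \<theta>))\<^sup>2) \<le> max_sum g J \<theta>"
  unfolding max_sum_def by (rule SUP_upper2[of "(p, q)"]) simp_all

lemma max_sum_mono: "J \<subseteq> J' \<Longrightarrow> max_sum g J \<theta> \<le> max_sum g J' \<theta>"
  unfolding max_sum_def by (rule SUP_subset_mono) (blast, rule order_refl)

lemma borel_measurable_max_sum [measurable]: "max_sum g J \<in> borel_measurable circle_measure"
proof -
  have [measurable]: "fourier_term g k \<in> borel_measurable circle_measure" for k
    by (intro borel_measurable_integrable[OF continuous_integrable_circle] continuous_intros)
  show ?thesis
    unfolding max_sum_def[abs_def] case_prod_beta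
    by (intro borel_measurable_SUP countableI_type) measurable
qed

text \<open>Reduces an infinite index set to finite ones, so that the Hardy inequality is needed only for
  trigonometric polynomials and no convergence of Fourier series enters.\<close>

lemma max_sum_exhaust: "max_sum g J \<theta> = (SUP N. max_sum g (J \<inter> {..N}) \<theta>)"
proof (rule antisym)
  show "max_sum g J \<theta> \<le> (SUP N. max_sum g (J \<inter> {..N}) \<theta>)"
    unfolding max_sum_def[of g J]
  proof (rule SUP_least, clarify)
    fix p q :: nat assume "p \<le> q" "{p..q} \<subseteq> J"
    then show "ennreal ((cmod (\<Sum>k=p..q. fourier_term g k \<theta>))\<^sup>2) \<le> (SUP N. max_sum g (J \<inter> {..N}) \<theta>)"
      by (intro SUP_upper2[of q] max_sum_upper) auto
  qed
  show "(SUP N. max_sum g (J \<inter> {..N}) \<theta>) \<le> max_sum g J \<theta>"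
    by (intro SUP_least max_sum_mono) simp
qed

text \<open>On runs of indices inside \<open>K\<close>, the partial sums of \<open>g\<close> and of the trigonometric polynomial
  \<open>fourier_block g K\<close> agree; the energy of the latter involves the indices in \<open>K\<close> only.\<close>

lemma hardy_max_sum_finite:
  assumes "hardy_constant C" "finite K" "0 \<notin> K"
  shows "(\<integral>\<^sup>+\<theta>. max_sum g K \<theta> \<partial>circle_measure)
    \<le> ennreal C * (\<Sum>n\<in>K. ennreal (4 * pi * (cmod (fourier_coeff g (int n)))\<^sup>2))"
proof -
  let ?b = "fourier_block g K"
  have "(\<integral>\<^sup>+\<theta>. max_sum g K \<theta> \<partial>circle_measure)
     \<le> (\<integral>\<^sup>+\<theta>. (SUP (i, j)\<in>{(i, j). i \<le> j}. ennreal ((cmod (\<Sum>k=i..j. fourier_term ?b k \<theta>))\<^sup>2)) \<partial>circle_measure)"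
    unfolding max_sum_def
  proof (intro nn_integral_mono SUP_least, clarify)
    fix \<theta> and p q :: nat assume pq: "p \<le> q" "{p..q} \<subseteq> K"
    then have eq: "(\<Sum>k=p..q. fourier_term g k \<theta>) = (\<Sum>k=p..q. fourier_term ?b k \<theta>)"
      by (intro sum.cong refl) (simp add: fourier_term_block[OF assms(2,3)] subset_iff)
    show "ennreal ((cmod (\<Sum>k=p..q. fourier_term g k \<theta>))\<^sup>2)
        \<le> (SUP (i, j)\<in>{(i, j). i \<le> j}. ennreal ((cmod (\<Sum>k=i..j. fourier_term ?b k \<theta>))\<^sup>2))"
      unfolding eq using pq(1) by (intro SUP_upper2[of "(p, q)"]) simp_all
  qed
  also have "\<dots> \<le> ennreal C * (\<integral>\<^sup>+\<theta>. ennreal (\<bar>?b \<theta>\<bar>\<^sup>2) \<partial>circle_measure)"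
    by (rule assms(1)[unfolded hardy_constant_def, rule_format, OF L2_circle_fourier_block])
  finally show ?thesis
    by (simp add: nn_integral_fourier_block_square[OF assms(2,3)])
qed

lemma hardy_max_sum:
  assumes "hardy_constant C" "0 \<notin> J"
  shows "(\<integral>\<^sup>+\<theta>. max_sum g J \<theta> \<partial>circle_measure)
    \<le> ennreal C * (\<Sum>n. ennreal (4 * pi * (cmod (fourier_coeff g (int n)))\<^sup>2) * indicator J n)"
proof -
  have "(\<integral>\<^sup>+\<theta>. max_sum g J \<theta> \<partial>circle_measure) = (\<integral>\<^sup>+\<theta>. (SUP N. max_sum g (J \<inter> {..N}) \<theta>) \<partial>circle_measure)"
    by (intro nn_integral_cong max_sum_exhaust)
  also have "\<dots> = (SUP N. \<integral>\<^sup>+\<theta>. max_sum g (J \<inter> {..N}) \<theta> \<partial>circle_measure)"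
  proof (rule nn_integral_monotone_convergence_SUP)
    show "incseq (\<lambda>N \<theta>. max_sum g (J \<inter> {..N}) \<theta>)"
      unfolding incseq_def le_fun_def
      by (intro allI impI max_sum_mono) auto
  qed simp
  also have "\<dots> \<le> ennreal C * (\<Sum>n. ennreal (4 * pi * (cmod (fourier_coeff g (int n)))\<^sup>2) * indicator J n)"
  proof (rule SUP_least)
    fix N
    have "(\<integral>\<^sup>+\<theta>. max_sum g (J \<inter> {..N}) \<theta> \<partial>circle_measure)
        \<le> ennreal C * (\<Sum>n\<in>J \<inter> {..N}. ennreal (4 * pi * (cmod (fourier_coeff g (int n)))\<^sup>2))"
      using assms by (intro hardy_max_sum_finite) auto
    also have "\<dots> \<le> ennreal C * (\<Sum>n. ennreal (4 * pi * (cmod (fourier_coeff g (int n)))\<^sup>2) * indicator J n)"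
    proof (rule mult_left_mono)
      have "(\<Sum>n\<in>J \<inter> {..N}. ennreal (4 * pi * (cmod (fourier_coeff g (int n)))\<^sup>2))
         = (\<Sum>n\<in>J \<inter> {..N}. ennreal (4 * pi * (cmod (fourier_coeff g (int n)))\<^sup>2) * indicator J n)"
        by (intro sum.cong) auto
      also have "\<dots> \<le> (\<Sum>n. ennreal (4 * pi * (cmod (fourier_coeff g (int n)))\<^sup>2) * indicator J n)"
        by (rule sum_le_suminf) auto
      finally show "(\<Sum>n\<in>J \<inter> {..N}. ennreal (4 * pi * (cmod (fourier_coeff g (int n)))\<^sup>2))
         \<le> (\<Sum>n. ennreal (4 * pi * (cmod (fourier_coeff g (int n)))\<^sup>2) * indicator J n)" .
    qed simp
    finally show "(\<integral>\<^sup>+\<theta>. max_sum g (J \<inter> {..N}) \<theta> \<partial>circle_measure)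
        \<le> ennreal C * (\<Sum>n. ennreal (4 * pi * (cmod (fourier_coeff g (int n)))\<^sup>2) * indicator J n)" .
  qed
  finally show ?thesis .
qed

text \<open>The cost \<open>c m\<close> is \<open>block_max f (node m)\<close>. Taking the maximum in each coordinate separately makes the
  scalar Hardy inequality applicable; for vectors it can only increase the value.\<close>

definition block_max :: "(real \<Rightarrow> real^'d) \<Rightarrow> nat set \<Rightarrow> real \<Rightarrow> ennreal" where
  "block_max f J \<theta> = (\<Sum>i\<in>UNIV. max_sum (\<lambda>t. f t $ i) J \<theta>)"

lemma borel_measurable_block_max [measurable]: "block_max f J \<in> borel_measurable circle_measure"
  unfolding block_max_def[abs_def] by measurable

lemma cmod_raw_coeff: "cmod (raw_coeff f n $ i) = 2 * pi * cmod (fourier_coeff (\<lambda>t. f t $ i) (int n))"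
proof -
  have "raw_coeff f n $ i = 2 * of_real pi * fourier_coeff (\<lambda>t. f t $ i) (- int n)"
    by (simp add: raw_coeff_def fourier_coeff_def)
  then show ?thesis by (simp add: fourier_coeff_uminus norm_mult)
qed

text \<open>For \<open>n > 0\<close> the left-hand side is the energy of the \<open>n\<close>-th Fourier term; the right-hand side has the
  normalisation in which the half energy inequality is stated.\<close>

lemma sum_component_energy:
  "(\<Sum>i\<in>UNIV. ennreal (4 * pi * (cmod (fourier_coeff (\<lambda>t. f t $ i) (int n)))\<^sup>2)) = ennreal ((norm (raw_coeff f n))\<^sup>2 / pi)"
proof -
  have "(norm (raw_coeff f n))\<^sup>2 / pi = (\<Sum>i\<in>UNIV. (cmod (raw_coeff f n $ i))\<^sup>2) / pi"
    by (simp add: norm_vec_def L2_set_def sum_nonneg)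
  also have "\<dots> = (\<Sum>i\<in>UNIV. 4 * pi * (cmod (fourier_coeff (\<lambda>t. f t $ i) (int n)))\<^sup>2)"
    by (simp add: cmod_raw_coeff sum_divide_distrib power2_eq_square field_simps)
  finally show ?thesis by (simp add: sum_ennreal)
qed

lemma hardy_block_max:
  assumes "hardy_constant C" "0 \<notin> J"
  shows "(\<integral>\<^sup>+\<theta>. block_max f J \<theta> \<partial>circle_measure)
    \<le> ennreal C * (\<Sum>n. ennreal ((norm (raw_coeff f n))\<^sup>2 / pi) * indicator J n)"
proof -
  let ?e = "\<lambda>i n. ennreal (4 * pi * (cmod (fourier_coeff (\<lambda>t. f t $ i) (int n)))\<^sup>2)"
  have "(\<integral>\<^sup>+\<theta>. block_max f J \<theta> \<partial>circle_measure) = (\<Sum>i\<in>UNIV. \<integral>\<^sup>+\<theta>. max_sum (\<lambda>t. f t $ i) J \<theta> \<partial>circle_measure)"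
    unfolding block_max_def by (rule nn_integral_sum) simp
  also have "\<dots> \<le> (\<Sum>i\<in>UNIV. ennreal C * (\<Sum>n. ?e i n * indicator J n))"
    by (intro sum_mono hardy_max_sum assms)
  also have "\<dots> = ennreal C * (\<Sum>n. \<Sum>i\<in>UNIV. ?e i n * indicator J n)"
    by (simp only: suminf_sum[OF summableI] sum_distrib_left)
  also have "\<dots> = ennreal C * (\<Sum>n. ennreal ((norm (raw_coeff f n))\<^sup>2 / pi) * indicator J n)"
    by (simp only: sum_distrib_right[symmetric] sum_component_energy)
  finally show ?thesis .
qed

lemma norm_increment_le_block_max:
  assumes "k < l" "{k<..l} \<subseteq> J"
  shows "ennreal ((norm (partial_sum_process f \<theta> l - partial_sum_process f \<theta> k))\<^sup>2) \<le> block_max f J \<theta>"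
proof -
  let ?s = "\<lambda>i. \<Sum>n=Suc k..l. fourier_term (\<lambda>t. f t $ i) n \<theta>"
  have split: "{..l} = {..k} \<union> {Suc k..l}" using assms(1) by auto
  have comp: "(partial_sum_process f \<theta> l - partial_sum_process f \<theta> k) $ i = Re (?s i)" for i
    unfolding partial_sum_process_def split by (subst sum.union_disjoint) auto
  have "(norm (partial_sum_process f \<theta> l - partial_sum_process f \<theta> k))\<^sup>2 = (\<Sum>i\<in>UNIV. (Re (?s i))\<^sup>2)"
    unfolding norm_vec_def L2_set_def comp by (simp add: sum_nonneg)
  also have "ennreal \<dots> = (\<Sum>i\<in>UNIV. ennreal ((Re (?s i))\<^sup>2))"
    by (simp add: sum_ennreal)
  also have "\<dots> \<le> block_max f J \<theta>"
    unfolding block_max_def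
  proof (rule sum_mono)
    fix i
    have "(Re (?s i))\<^sup>2 \<le> (cmod (?s i))\<^sup>2"
      using abs_Re_le_cmod[of "?s i"] by (metis abs_ge_zero power2_abs power_mono)
    then have "ennreal ((Re (?s i))\<^sup>2) \<le> ennreal ((cmod (?s i))\<^sup>2)"
      by (rule ennreal_leI)
    also have "\<dots> \<le> max_sum (\<lambda>t. f t $ i) J \<theta>"
      using assms by (intro max_sum_upper) auto
    finally show "ennreal ((Re (?s i))\<^sup>2) \<le> max_sum (\<lambda>t. f t $ i) J \<theta>" .
  qed
  finally show ?thesis .
qed

section \<open>Chen's relation for the area\<close>

lemma is_norm_sum_le: "is_norm nrm \<Longrightarrow> nrm (x + y) \<le> nrm x + nrm y"
  by (simp add: is_norm_def)

lemma tensor_norm_bracket_le: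
  assumes "tensor_norm nrm"
  shows "nrm (bracket u v) \<le> 2 * (norm u * norm v)"
proof -
  have n: "is_norm nrm" and t: "\<And>u v. nrm (tensor u v) \<le> norm u * norm v"
    using assms by (auto simp: tensor_norm_def)
  have "bracket u v = tensor u v + (-1) *\<^sub>R tensor v u"
    by (simp add: bracket_def)
  then have "nrm (bracket u v) \<le> nrm (tensor u v) + nrm ((-1) *\<^sub>R tensor v u)"
    using n unfolding is_norm_def by metis
  also have "nrm ((-1) *\<^sub>R tensor v u) = \<bar>-1\<bar> * nrm (tensor v u)"
    using n unfolding is_norm_def by blast
  finally show ?thesis
    using t[of u v] t[of v u] by (simp add: mult.commute)
qed

lemma bracket_sum:
  "bracket (sum g A) (sum h B) = (\<Sum>(i, j)\<in>A \<times> B. bracket (g i) (h j))"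
proof -
  have "bracket (sum g A) (sum h B) = (\<Sum>i\<in>A. \<Sum>j\<in>B. bracket (g i) (h j))"
  proof -
    have "(\<Sum>i\<in>A. \<Sum>j\<in>B. h j $ a * g i $ b) = (\<Sum>j\<in>B. \<Sum>i\<in>A. h j $ a * g i $ b)" for a b
      by (rule sum.swap)
    then show ?thesis
      by (simp add: vec_eq_iff bracket_def tensor_def sum_component sum_product sum_subtractf)
  qed
  then show ?thesis by (simp add: sum.cartesian_product)
qed

lemma area_eq_sum:
  "area \<gamma> k l = (1 / 2) *\<^sub>R (\<Sum>(i, j)\<in>{(i, j). k \<le> i \<and> i < j \<and> j < l}.
     bracket (\<gamma> (i + 1) - \<gamma> i) (\<gamma> (j + 1) - \<gamma> j))"
proof (cases "l \<le> k + 1")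
  case True
  then have "{(i, j). k \<le> i \<and> i < j \<and> j < l} = {}" by auto
  then show ?thesis by (simp only: area_def True if_True sum.empty scaleR_zero_right)
next
  case False
  then have "{(i, j). k \<le> i \<and> i < j \<and> j \<le> l - 1} = {(i, j). k \<le> i \<and> i < j \<and> j < l}" by auto
  then show ?thesis using False by (simp add: area_def)
qed

text \<open>Chen's relation: the indices of a pair \<open>k \<le> i < j < l\<close> lie both below \<open>m\<close>, or both above, or on different sides, and the
  pairs of the last kind form a rectangle, over which the bilinear bracket of increments telescopes.\<close>

lemma area_chen:
  assumes "k \<le> m" "m \<le> l"
  shows "area \<gamma> k l = area \<gamma> k m + area \<gamma> m l + (1 / 2) *\<^sub>R bracket (\<gamma> m - \<gamma> k) (\<gamma> l - \<gamma> m)"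
proof -
  define pairs where "pairs = (\<lambda>a b. {(i, j). a \<le> i \<and> i < j \<and> j < (b::nat)})"
  define F where "F = (\<lambda>(i, j). bracket (\<gamma> (i + 1) - \<gamma> i) (\<gamma> (j + 1) - \<gamma> j))"
  have fin: "finite (pairs a b)" for a b
    by (rule finite_subset[of _ "{..<b} \<times> {..<b}"]) (auto simp: pairs_def)
  have area: "area \<gamma> a b = (1 / 2) *\<^sub>R sum F (pairs a b)" for a b
    by (simp add: area_eq_sum F_def pairs_def)
  have tele: "(\<Sum>i\<in>{a..<b}. \<gamma> (i + 1) - \<gamma> i) = \<gamma> b - \<gamma> a" if "a \<le> b" for a b
    using sum_Suc_diff'[OF that, of \<gamma>] by simp
  have "pairs k l = (pairs k m \<union> pairs m l) \<union> {k..<m} \<times> {m..<l}"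
    using assms by (auto simp: pairs_def)
  also have "sum F \<dots> = sum F (pairs k m) + sum F (pairs m l) + sum F ({k..<m} \<times> {m..<l})"
    by (subst sum.union_disjoint, simp add: fin, simp add: fin, force simp: pairs_def)+ simp
  also have "sum F ({k..<m} \<times> {m..<l}) = bracket (\<gamma> m - \<gamma> k) (\<gamma> l - \<gamma> m)"
    unfolding F_def bracket_sum[symmetric] tele[OF assms(1)] tele[OF assms(2)] ..
  finally show ?thesis
    by (simp add: area scaleR_add_right)
qed

lemma tensor_norm_area_chen:
  assumes "tensor_norm nrm" "k \<le> m" "m \<le> l"
    and "(norm (\<gamma> m - \<gamma> k))\<^sup>2 \<le> c" "(norm (\<gamma> l - \<gamma> m))\<^sup>2 \<le> c"
  shows "nrm (area \<gamma> k l) \<le> nrm (area \<gamma> k m) + nrm (area \<gamma> m l) + c"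
proof -
  have n: "is_norm nrm" using assms(1) by (simp add: tensor_norm_def)
  let ?u = "\<gamma> m - \<gamma> k" and ?v = "\<gamma> l - \<gamma> m"
  have "nrm (area \<gamma> k l) \<le> nrm (area \<gamma> k m + area \<gamma> m l) + nrm ((1 / 2) *\<^sub>R bracket ?u ?v)"
    unfolding area_chen[OF assms(2,3)] by (rule is_norm_sum_le[OF n])
  also have "nrm (area \<gamma> k m + area \<gamma> m l) \<le> nrm (area \<gamma> k m) + nrm (area \<gamma> m l)"
    by (rule is_norm_sum_le[OF n])
  also have "nrm ((1 / 2) *\<^sub>R bracket ?u ?v) = \<bar>1 / 2\<bar> * nrm (bracket ?u ?v)"
    using n unfolding is_norm_def by blast
  also have "\<dots> \<le> norm ?u * norm ?v"
    using tensor_norm_bracket_le[OF assms(1), of ?u ?v] by simp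
  also have "\<dots> \<le> c"
    using assms(4,5) sum_squares_bound[of "norm ?u" "norm ?v"] by (simp add: field_simps)
  finally show ?thesis by simp
qed

section \<open>Pointwise control of the variations\<close>

text \<open>The leaves of the tree, indexed by all of \<open>nat\<close>; removing \<open>0\<close> makes \<open>leaf 0\<close> empty, since the increments of the partial
  sum process involve only the positive frequencies.\<close>

definition leaf :: "nat \<Rightarrow> nat set" where
  "leaf n = {n} - {0}"

definition variation_majorant :: "(real \<Rightarrow> real^'d) \<Rightarrow> real \<Rightarrow> ennreal" where
  "variation_majorant f \<theta> = (\<Sum>m. block_max f (node m) \<theta>) + (\<Sum>n. block_max f (leaf n) \<theta>)"

lemma borel_measurable_variation_majorant [measurable]:
  "variation_majorant f \<in> borel_measurable circle_measure"
  unfolding variation_majorant_def[abs_def] by measurable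

text \<open>A squared increment inside \<open>node m\<close> is at most the cost of that node, which gives
  the splitting inequality at once.\<close>

lemma square_variation_le_majorant:
  "(p_variation norm 2 (increments (partial_sum_process f \<theta>)))\<^sup>2 \<le> variation_majorant f \<theta>"
proof (cases "variation_majorant f \<theta>")
  case (real \<psi>)
  let ?X = "partial_sum_process f \<theta>"
  define \<omega> where "\<omega> = (\<lambda>k l. ennreal (norm (increments ?X k l) powr 2))"
  have \<omega>: "\<omega> k l \<le> block_max f J \<theta>" if "k < l" "{k<..l} \<subseteq> J" for k l J
    using norm_increment_le_block_max[OF that, of f \<theta>]
    by (simp add: \<omega>_def increments_def norm_minus_commute)
  have "p_variation norm 2 (increments ?X) \<le> ennreal (\<psi> powr (1 / 2))"
  proof (rule p_variation_le)
    fix n :: nat and k :: "nat \<Rightarrow> nat" assume "strict_mono_on {..n} k"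
    then have "(\<Sum>j<n. \<omega> (k j) (k (Suc j))) \<le> (\<Sum>m. block_max f (node m) \<theta>) + (\<Sum>n. block_max f (leaf n) \<theta>)"
    proof (rule partition_control[rotated 2])
      show "\<omega> k (k + 1) \<le> block_max f (leaf (k + 1)) \<theta>" for k
        by (rule \<omega>) (auto simp: leaf_def)
      show "\<omega> k l \<le> \<omega> k m + \<omega> m l + block_max f (node m) \<theta>" if "k < m" "m < l" "{k<..l} \<subseteq> node m" for k m l
        using that by (intro add_increasing \<omega>) auto
    qed
    then show "(\<Sum>j<n. ennreal (norm (increments ?X (k j) (k (Suc j))) powr 2)) \<le> ennreal \<psi>"
      using real(2) by (simp add: variation_majorant_def \<omega>_def)
  qed (use real in auto)
  then have "(p_variation norm 2 (increments ?X))\<^sup>2 \<le> (ennreal (\<psi> powr (1 / 2)))\<^sup>2"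
    by (intro power_mono) auto
  also have "\<dots> = ennreal \<psi>"
    using real(1) by (simp add: ennreal_power powr_half_sqrt)
  finally show ?thesis using real(2) by simp
qed simp

text \<open>By \<open>tensor_norm_area_chen\<close> the area satisfies the splitting inequality with the cost that serves
  the squared increments, and it vanishes on intervals with one element.\<close>

lemma area_variation_le_majorant:
  assumes "tensor_norm nrm"
  shows "p_variation nrm 1 (area (partial_sum_process f \<theta>)) \<le> variation_majorant f \<theta>"
proof (cases "variation_majorant f \<theta>")
  case (real \<psi>)
  let ?X = "partial_sum_process f \<theta>"
  have n: "is_norm nrm" using assms by (simp add: tensor_norm_def)
  have nonneg: "0 \<le> nrm a" for a using n by (simp add: is_norm_def)
  define \<omega> where "\<omega> = (\<lambda>k l. ennreal (nrm (area ?X k l)))"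
  have "p_variation nrm 1 (area ?X) \<le> ennreal (\<psi> powr (1 / 1))"
  proof (rule p_variation_le)
    fix n :: nat and k :: "nat \<Rightarrow> nat" assume "strict_mono_on {..n} k"
    then have "(\<Sum>j<n. \<omega> (k j) (k (Suc j))) \<le> (\<Sum>m. block_max f (node m) \<theta>) + (\<Sum>n. block_max f (leaf n) \<theta>)"
    proof (rule partition_control[rotated 2])
      show "\<omega> k (k + 1) \<le> block_max f (leaf (k + 1)) \<theta>" for k
      proof -
        have "nrm 0 = 0" using n by (auto simp: is_norm_def)
        then show ?thesis by (simp add: \<omega>_def area_def)
      qed
      show "\<omega> k l \<le> \<omega> k m + \<omega> m l + block_max f (node m) \<theta>" if km: "k < m" "m < l" "{k<..l} \<subseteq> node m" for k m l
      proof (cases "block_max f (node m) \<theta>")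
        case c: (real c)
        have "ennreal ((norm (?X m - ?X k))\<^sup>2) \<le> block_max f (node m) \<theta>"
          "ennreal ((norm (?X l - ?X m))\<^sup>2) \<le> block_max f (node m) \<theta>"
          using km by (auto intro!: norm_increment_le_block_max)
        then have "nrm (area ?X k l) \<le> nrm (area ?X k m) + nrm (area ?X m l) + c"
          using km c by (intro tensor_norm_area_chen[OF assms]) simp_all
        then show ?thesis
          using c nonneg by (simp add: \<omega>_def ennreal_leI flip: ennreal_plus)
      qed simp
    qed
    then show "(\<Sum>j<n. ennreal (nrm (area ?X (k j) (k (Suc j))) powr 1)) \<le> ennreal \<psi>"
      using real(2) nonneg by (simp add: variation_majorant_def \<omega>_def)
  qed (use real in auto)
  then show ?thesis using real by simp
qed simp

lemma rough_norm_le_majorant: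
  assumes "tensor_norm nrm"
  shows "(rough_norm nrm (enhanced (partial_sum_process f) \<theta>))\<^sup>2 \<le> 2 * variation_majorant f \<theta>"
  using add_mono[OF square_variation_le_majorant area_variation_le_majorant[OF assms]]
  by (simp add: rough_norm_def enhanced_def area_process_def[abs_def] ennreal_sqrt_square mult_2)

section \<open>Integration of the majorant\<close>

lemma suminf_swap_ennreal:
  fixes F :: "nat \<Rightarrow> nat \<Rightarrow> ennreal"
  shows "(\<Sum>m. \<Sum>n. F m n) = (\<Sum>n. \<Sum>m. F m n)"
proof -
  have "(\<Sum>m. \<Sum>n. F m n) = (\<Sum>m. \<integral>\<^sup>+n. F m n \<partial>count_space UNIV)"
    by (simp add: nn_integral_count_space_nat)
  also have "\<dots> = (\<integral>\<^sup>+n. (\<Sum>m. F m n) \<partial>count_space UNIV)"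
    by (rule nn_integral_suminf[symmetric]) simp
  finally show ?thesis by (simp add: nn_integral_count_space_nat)
qed

text \<open>Exchanging the sums counts the nodes that contain \<open>n\<close>.\<close>

lemma sum_over_nodes:
  fixes a :: "nat \<Rightarrow> ennreal"
  shows "(\<Sum>m. \<Sum>n. a n * indicator (node m) n) \<le> (\<Sum>n. a n * ennreal (6 * log 2 (real n + 1)))"
proof -
  have "(\<Sum>m. a n * indicator (node m) n) \<le> a n * ennreal (6 * log 2 (real n + 1))" for n
  proof (cases "n = 0")
    case True
    then show ?thesis using zero_notin_node by simp
  next
    case False
    then have n: "1 \<le> n" by simp
    have "(\<Sum>m. a n * indicator (node m) n) = (\<Sum>m\<in>{m. n \<in> node m}. a n * indicator (node m) n)"
      by (rule suminf_finite[OF node_overlap(1)[OF n]]) simp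
    also have "\<dots> = a n * ennreal (real (card {m. n \<in> node m}))"
      by (simp add: ennreal_of_nat_eq_real_of_nat mult.commute)
    also have "\<dots> \<le> a n * ennreal (6 * log 2 (real n + 1))"
      by (intro mult_left_mono ennreal_leI node_overlap(2) n) simp
    finally show ?thesis .
  qed
  then show ?thesis
    by (subst suminf_swap_ennreal) (intro suminf_le, auto)
qed

lemma sum_over_leaves:
  fixes a :: "nat \<Rightarrow> ennreal"
  shows "(\<Sum>m. \<Sum>n. a n * indicator (leaf m) n) \<le> (\<Sum>n. a n * ennreal (log 2 (real n + 1)))"
proof -
  have "(\<Sum>m. a n * indicator (leaf m) n) \<le> a n * ennreal (log 2 (real n + 1))" for n
  proof -
    have "(\<Sum>m. a n * indicator (leaf m) n) = (\<Sum>m\<in>{n}. a n * indicator (leaf m) n)"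
      by (rule suminf_finite) (auto simp: leaf_def)
    also have "\<dots> \<le> a n * ennreal (log 2 (real n + 1))"
    proof (cases "n = 0")
      case False
      then have "ennreal 1 \<le> ennreal (log 2 (real n + 1))"
        by (intro ennreal_leI) simp
      then have "a n * ennreal 1 \<le> a n * ennreal (log 2 (real n + 1))"
        by (rule mult_left_mono) simp
      with False show ?thesis by (simp add: leaf_def)
    qed (simp add: leaf_def)
    finally show ?thesis .
  qed
  then show ?thesis
    by (subst suminf_swap_ennreal) (intro suminf_le, auto)
qed

lemma integral_variation_majorant:
  assumes "hardy_constant C"
  shows "(\<integral>\<^sup>+\<theta>. variation_majorant f \<theta> \<partial>circle_measure)
    \<le> ennreal C * ennreal (7 / pi) * (\<Sum>n. ennreal (log 2 (real n + 1) * (norm (raw_coeff f n))\<^sup>2))"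
proof -
  let ?e = "\<lambda>n. ennreal ((norm (raw_coeff f n))\<^sup>2 / pi)"
  let ?W = "\<Sum>n. ennreal (log 2 (real n + 1) * (norm (raw_coeff f n))\<^sup>2)"
  have "(\<integral>\<^sup>+\<theta>. variation_majorant f \<theta> \<partial>circle_measure)
      = (\<Sum>m. \<integral>\<^sup>+\<theta>. block_max f (node m) \<theta> \<partial>circle_measure) + (\<Sum>m. \<integral>\<^sup>+\<theta>. block_max f (leaf m) \<theta> \<partial>circle_measure)"
    unfolding variation_majorant_def
    by (simp add: nn_integral_add nn_integral_suminf)
  also have "\<dots> \<le> (\<Sum>m. ennreal C * (\<Sum>n. ?e n * indicator (node m) n)) + (\<Sum>m. ennreal C * (\<Sum>n. ?e n * indicator (leaf m) n))"
    by (intro add_mono suminf_le hardy_block_max assms zero_notin_node) (auto simp: leaf_def)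
  also have "\<dots> = ennreal C * ((\<Sum>m. \<Sum>n. ?e n * indicator (node m) n) + (\<Sum>m. \<Sum>n. ?e n * indicator (leaf m) n))"
    by (simp add: distrib_left)
  also have "\<dots> \<le> ennreal C * ((\<Sum>n. ?e n * ennreal (6 * log 2 (real n + 1))) + (\<Sum>n. ?e n * ennreal (log 2 (real n + 1))))"
    by (intro mult_left_mono add_mono sum_over_nodes sum_over_leaves) simp
  also have "\<dots> = ennreal C * (\<Sum>n. ennreal (7 / pi) * ennreal (log 2 (real n + 1) * (norm (raw_coeff f n))\<^sup>2))"
  proof -
    have "?e n * ennreal (6 * log 2 (real n + 1)) + ?e n * ennreal (log 2 (real n + 1))
        = ennreal (7 / pi) * ennreal (log 2 (real n + 1) * (norm (raw_coeff f n))\<^sup>2)" for n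
      by (simp add: field_simps flip: ennreal_mult ennreal_plus)
    then show ?thesis by (simp add: suminf_add)
  qed
  also have "\<dots> = ennreal C * ennreal (7 / pi) * ?W"
    by (simp add: mult.assoc)
  finally show ?thesis .
qed

section \<open>Finite half energy\<close>

text \<open>Since the integral over \<open>u\<close> is finite, the inner integral is finite for at least one \<open>u\<close>. As
  \<open>\<bar>sin x\<bar> \<le> 1\<close>, it dominates the squared \<open>L\<^sup>2\<close> distance between \<open>f\<close> and the constant \<open>f u\<close>.\<close>

lemma L2_circle_of_half_energy:
  fixes f :: "real \<Rightarrow> 'a::euclidean_space"
  assumes meas: "f \<in> borel_measurable circle_measure" and fin: "half_energy f < \<infinity>"
  shows "L2_circle f"
proof -
  let ?I = "\<lambda>u. \<integral>\<^sup>+v. ennreal ((norm (f u - f v))\<^sup>2 / \<bar>sin ((u - v) / 2)\<bar>) \<partial>circle_measure"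
  have [measurable]: "f \<in> borel_measurable circle_measure" by (rule meas)
  have total: "emeasure circle_measure {-pi..pi} = ennreal (2 * pi)"
    by (simp add: emeasure_restrict_space)
  have "\<exists>u\<in>{-pi..pi}. ?I u < \<infinity>"
  proof (rule ccontr)
    assume none: "\<not> (\<exists>u\<in>{-pi..pi}. ?I u < \<infinity>)"
    have "?I u = \<infinity>" if "u \<in> {-pi..pi}" for u
    proof -
      have "\<not> ?I u < \<infinity>" using none that by blast
      then show ?thesis by (simp only: infinity_ennreal_def less_top[symmetric] not_not)
    qed
    then have "half_energy f = (\<integral>\<^sup>+u. \<infinity> \<partial>circle_measure)"
      unfolding half_energy_def by (intro nn_integral_cong) simp
    also have "\<dots> = \<infinity>"
      using total by (simp add: ennreal_top_mult)
    finally show False using fin by simp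
  qed
  then obtain u where u: "u \<in> {-pi..pi}" "?I u < \<infinity>" by blast
  \<comment> \<open>On \<open>Z\<close> the denominator vanishes and the quotient is \<open>0\<close> by convention.\<close>
  define Z where "Z = {u, u - 2 * pi, u + 2 * pi}"
  have "Z \<in> null_sets lebesgue"
    unfolding Z_def by (intro null_sets_completionI finite_imp_null_set_lborel) simp
  then have "AE v in lebesgue. v \<notin> Z" by (rule AE_not_in)
  then have "AE v in lebesgue. v \<in> {-pi..pi} \<longrightarrow> v \<notin> Z" by eventually_elim blast
  then have "AE v in circle_measure. v \<notin> Z"
    by (simp add: AE_restrict_space_iff)
  then have "AE v in circle_measure. ennreal ((norm (f u - f v))\<^sup>2) \<le> ennreal ((norm (f u - f v))\<^sup>2 / \<bar>sin ((u - v) / 2)\<bar>)"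
    using AE_space
  proof eventually_elim
    case (elim v)
    have "sin ((u - v) / 2) \<noteq> 0"
    proof
      assume "sin ((u - v) / 2) = 0"
      then obtain i :: int where i: "(u - v) / 2 = of_int i * pi"
        by (auto simp: sin_zero_iff_int2)
      have "\<bar>of_int i * pi\<bar> \<le> 1 * pi"
        using u(1) elim(2) unfolding i[symmetric] by (simp add: space_restrict_space abs_le_iff field_simps)
      then have "\<bar>real_of_int i\<bar> \<le> 1"
        by (simp add: abs_mult)
      then have "i = -1 \<or> i = 0 \<or> i = 1" by linarith
      with i elim(1) show False by (auto simp: Z_def)
    qed
    then have "(norm (f u - f v))\<^sup>2 / 1 \<le> (norm (f u - f v))\<^sup>2 / \<bar>sin ((u - v) / 2)\<bar>"
      by (intro divide_left_mono) auto
    then show ?case by (simp add: ennreal_leI)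
  qed
  then have "(\<integral>\<^sup>+v. ennreal ((norm (f u - f v))\<^sup>2) \<partial>circle_measure) \<le> ?I u"
    by (rule nn_integral_mono_AE)
  then have le: "(\<integral>\<^sup>+v. ennreal ((norm (f u - f v))\<^sup>2) \<partial>circle_measure) < \<infinity>"
    using u(2) by (rule le_less_trans)
  have "(\<integral>\<^sup>+v. ennreal ((norm (f v))\<^sup>2) \<partial>circle_measure)
      \<le> (\<integral>\<^sup>+v. ennreal (2 * (norm (f u))\<^sup>2) + 2 * ennreal ((norm (f u - f v))\<^sup>2) \<partial>circle_measure)"
  proof (intro nn_integral_mono)
    fix v
    have "(norm (f v))\<^sup>2 \<le> (norm (f u) + norm (f u - f v))\<^sup>2"
      by (intro power_mono norm_ge_zero) (metis norm_minus_commute norm_triangle_sub)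
    also have "\<dots> \<le> 2 * (norm (f u))\<^sup>2 + 2 * (norm (f u - f v))\<^sup>2"
      using sum_squares_bound[of "norm (f u)" "norm (f u - f v)"] by (simp add: power2_sum)
    finally show "ennreal ((norm (f v))\<^sup>2) \<le> ennreal (2 * (norm (f u))\<^sup>2) + 2 * ennreal ((norm (f u - f v))\<^sup>2)"
      by (simp add: ennreal_leI flip: ennreal_plus ennreal_mult'' ennreal_numeral)
  qed
  also have "\<dots> = ennreal (2 * (norm (f u))\<^sup>2) * ennreal (2 * pi) + 2 * (\<integral>\<^sup>+v. ennreal ((norm (f u - f v))\<^sup>2) \<partial>circle_measure)"
    using total by (simp add: nn_integral_add nn_integral_cmult)
  also have "\<dots> < \<infinity>"
    using le by (simp add: ennreal_mult_less_top)
  finally have "integrable circle_measure (\<lambda>v. (norm (f v))\<^sup>2)"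
    by (intro integrableI_nonneg) auto
  with meas show ?thesis by (simp add: L2_circle_def)
qed

section \<open>The rough path bound\<close>

theorem corollary19:
  fixes f :: "real \<Rightarrow> real^'d"
    and nrm :: "real^'d^'d \<Rightarrow> real"
    and C\<^sub>0 k_half :: real
  assumes "tensor_norm nrm"
    and "hardy_constant C\<^sub>0"
    and "half_energy_constant TYPE('d) k_half"
    and "f \<in> borel_measurable (lebesgue_on {-pi..pi})"
    and "half_energy f < \<infinity>"
  shows "L2_circle f
    \<and> geometric_2_rough_process nrm (enhanced (partial_sum_process f))
    \<and> (\<integral>\<^sup>+\<theta>. (rough_norm nrm (enhanced (partial_sum_process f) \<theta>))\<^sup>2 \<partial>lebesgue_on {-pi..pi})
        \<le> ennreal ((604 + 26 * C\<^sub>0) / k_half) * half_energy f"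
proof (intro conjI)
  let ?R = "\<lambda>\<theta>. rough_norm nrm (enhanced (partial_sum_process f) \<theta>)"
  let ?W = "\<Sum>n. ennreal (log 2 (real n + 1) * (norm (raw_coeff f n))\<^sup>2)"
  show L2: "L2_circle f"
    using assms(4,5) by (rule L2_circle_of_half_energy)
  have k: "0 < k_half" and kW: "ennreal k_half * ?W \<le> half_energy f"
    using assms(3) L2 by (auto simp: half_energy_constant_def)
  have "?W = ennreal (1 / k_half) * (ennreal k_half * ?W)"
    using k by (simp flip: mult.assoc ennreal_mult)
  also have "\<dots> \<le> ennreal (1 / k_half) * half_energy f"
    by (intro mult_left_mono kW) simp
  finally have W: "?W \<le> ennreal (1 / k_half) * half_energy f" .
  \<comment> \<open>When \<open>C\<^sub>0 < 0\<close> the left-hand side is \<open>0\<close>, as \<open>ennreal\<close> truncates negative numbers.\<close>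
  have const: "2 * (ennreal C\<^sub>0 * ennreal (7 / pi)) \<le> ennreal (604 + 26 * C\<^sub>0)"
  proof (cases "0 \<le> C\<^sub>0")
    case True
    have "14 / pi \<le> 26" using pi_gt3 by (simp add: field_simps)
    with True have "C\<^sub>0 * (14 / pi) \<le> C\<^sub>0 * 26" by (intro mult_left_mono)
    then have "2 * (C\<^sub>0 * (7 / pi)) \<le> 604 + 26 * C\<^sub>0" by (simp add: mult.commute)
    moreover have "2 * (ennreal C\<^sub>0 * ennreal (7 / pi)) = ennreal (2 * (C\<^sub>0 * (7 / pi)))"
      using True
      by (simp only: ennreal_mult mult_nonneg_nonneg zero_le_numeral divide_nonneg_nonneg pi_ge_zero ennreal_numeral)
    ultimately show ?thesis by (simp only: ennreal_leI)
  qed (simp add: ennreal_neg)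
  have majorant: "(\<integral>\<^sup>+\<theta>. 2 * variation_majorant f \<theta> \<partial>circle_measure) \<le> ennreal ((604 + 26 * C\<^sub>0) / k_half) * half_energy f"
  proof -
    have "(\<integral>\<^sup>+\<theta>. 2 * variation_majorant f \<theta> \<partial>circle_measure) = 2 * (\<integral>\<^sup>+\<theta>. variation_majorant f \<theta> \<partial>circle_measure)"
      by (rule nn_integral_cmult) simp
    also have "\<dots> \<le> 2 * (ennreal C\<^sub>0 * ennreal (7 / pi) * ?W)"
      by (intro mult_left_mono integral_variation_majorant assms) simp
    also have "\<dots> \<le> ennreal (604 + 26 * C\<^sub>0) * (ennreal (1 / k_half) * half_energy f)"
      unfolding mult.assoc[symmetric, of 2] by (intro mult_mono const[folded mult.assoc] W) simp_all
    also have "\<dots> = ennreal ((604 + 26 * C\<^sub>0) / k_half) * half_energy f"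
      using k by (simp flip: mult.assoc ennreal_mult'')
    finally show ?thesis .
  qed
  have "(\<integral>\<^sup>+\<theta>. (?R \<theta>)\<^sup>2 \<partial>circle_measure) \<le> (\<integral>\<^sup>+\<theta>. 2 * variation_majorant f \<theta> \<partial>circle_measure)"
    by (intro nn_integral_mono rough_norm_le_majorant assms(1))
  also note majorant
  finally show "(\<integral>\<^sup>+\<theta>. (?R \<theta>)\<^sup>2 \<partial>circle_measure) \<le> ennreal ((604 + 26 * C\<^sub>0) / k_half) * half_energy f" .
  have "(\<integral>\<^sup>+\<theta>. 2 * variation_majorant f \<theta> \<partial>circle_measure) < \<infinity>"
    using majorant by (rule le_less_trans) (use assms(5) in \<open>simp add: ennreal_mult_less_top\<close>)
  then have "AE \<theta> in circle_measure. 2 * variation_majorant f \<theta> \<noteq> \<infinity>"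
    by (intro nn_integral_PInf_AE) auto
  then show "geometric_2_rough_process nrm (enhanced (partial_sum_process f))"
    unfolding geometric_2_rough_process_def
  proof eventually_elim
    case (elim \<theta>)
    have "?R \<theta> \<noteq> \<infinity>"
    proof
      assume "?R \<theta> = \<infinity>"
      then have "(?R \<theta>)\<^sup>2 = \<infinity>" by (simp add: power2_eq_square ennreal_top_mult)
      with rough_norm_le_majorant[OF assms(1), of f \<theta>] elim show False
        by (simp add: top_unique)
    qed
    then show ?case by (simp add: less_top)
  qed
qed

end
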